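(* For any $c \in (0,0.02)$ and all sufficiently large positive integers $d$ (depending on $c$), $$f_{\pi/3 + c}(d) < (1+3.75c)^d.$$
   Context: For an integer $d\ge 2$ and a real number $\alpha\in(0,\pi)$, $f_\alpha(d)$ denotes the maximal cardinality of a set of points in $\mathbb{R}^d$ such that any angle formed by three (distinct) points of the set is strictly less than $\alpha$. *)

theory Defs
  imports "HOL-Analysis.Analysis"
begin

text \<open>
  The dimension has to be a quantified natural number, so \<open>\<real>\<^sup>d\<close> is the library's
  \<^term>\<open>topspace (Euclidean_space d)\<close>, i.e. the functions \<^typ>\<open>nat \<Rightarrow> real\<close> vanishing at all
  indices \<open>i \<ge> d\<close>. Equality of functions is thus equality of points.
\<close>

text \<open>The angle at the vertex \<open>y\<close>; it is meaningful only for \<open>x \<noteq> y\<close> and \<open>z \<noteq> y\<close>.\<close>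

definition angle_at :: "nat \<Rightarrow> (nat \<Rightarrow> real) \<Rightarrow> (nat \<Rightarrow> real) \<Rightarrow> (nat \<Rightarrow> real) \<Rightarrow> real" where
  "angle_at d x y z =
     arccos ((\<Sum>i<d. (x i - y i) * (z i - y i)) /
             (L2_set (\<lambda>i. x i - y i) {..<d} * L2_set (\<lambda>i. z i - y i) {..<d}))"

definition angles_below :: "real \<Rightarrow> nat \<Rightarrow> (nat \<Rightarrow> real) set \<Rightarrow> bool" where
  "angles_below \<alpha> d A \<longleftrightarrow>
     A \<subseteq> topspace (Euclidean_space d) \<and>
     (\<forall>x\<in>A. \<forall>y\<in>A. \<forall>z\<in>A. x \<noteq> y \<and> y \<noteq> z \<and> x \<noteq> z \<longrightarrow> angle_at d x y z < \<alpha>)"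

text \<open>
  The value lies in \<^typ>\<open>enat\<close> so that no finiteness is built in: it is \<open>\<infinity>\<close> if the cardinalities
  are unbounded, and otherwise the supremum is attained, i.e. is the maximal cardinality.
\<close>

definition max_card_angles :: "real \<Rightarrow> nat \<Rightarrow> enat" where
  "max_card_angles \<alpha> d =
     (SUP A\<in>{A. angles_below \<alpha> d A}. if finite A then enat (card A) else \<infinity>)"

end

theory Submission
  imports Defs
begin

text \<open>
  Let \<open>\<gamma> = cos (\<pi>/3 + c)\<close>, so that \<open>\<gamma>\<close> is slightly below \<open>1/2\<close>. The law of cosines at two vertices of
  a triangle shows that the two sides meeting at the third vertex have total length less than
  \<open>1/\<gamma>\<close> times the opposite side. Two things follow. All distances in the set agree up to the
  constant factor \<open>1/\<gamma>\<^sup>2\<close>. And in a triangle with two sides of length about \<open>1\<close>, the square of the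
  third side lies, up to small errors, between \<open>4\<gamma>\<^sup>2\<close> and \<open>2 - 2\<gamma>\<close>.

  Because the bound is exponential in \<open>d\<close>, a factor that depends on \<open>c\<close> only may be given away. Colour
  the pairs of points by the logarithm of their distance, rounded to a fine grid; boundedly many
  colours occur. The usual Ramsey argument for stars costs a constant factor and yields
  (\<open>nearly_equilateral_subsets\<close>) a set \<open>P\<close> of many points and a set \<open>S\<close> with a constant
  proportion of all points, such that all distances inside \<open>P\<close> and between \<open>P\<close> and \<open>S\<close> are about \<open>1\<close>.
  So \<open>P\<close> is nearly a regular simplex, and its centroid \<open>o\<close> has squared distance about \<open>1/2\<close>
  from each point of \<open>S\<close>. For distinct \<open>x, y \<in> S\<close> the inner product of \<open>x - o\<close> and \<open>y - o\<close> is then about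
  \<open>(1 - \<bar>x - y\<bar>\<^sup>2) / 2\<close>, which lies between \<open>(2\<gamma> - 1)/2\<close> and \<open>(1 - 4\<gamma>\<^sup>2)/2\<close>. Relative to the squared
  length \<open>1/2\<close> both are at most \<open>2\<surd>3 c\<close> in absolute value to first order, so after normalisation the
  vectors \<open>x - o\<close> are unit vectors with all mutual inner products at most \<open>\<epsilon> = 3.48 c\<close> in
  absolute value (\<open>centred_inner_bounds\<close>, \<open>cos_pi_third_plus_bounds\<close>).

  The number \<open>N\<close> of such vectors is bounded by a rank argument (\<open>card_nearly_orthogonal_le\<close>).
  The \<open>k\<close>-th powers of the inner products form a Gram matrix in the space of
  homogeneous polynomials of degree \<open>k\<close>, whose dimension \<open>R\<close> satisfies
  \<open>R x\<^sup>k \<le> (1 - x)\<^sup>-\<^sup>d\<close> for each \<open>0 < x < 1\<close>. Its diagonal entries are \<open>1\<close> and the others are at most \<open>\<epsilon>\<^sup>k\<close>, and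
  the square of the trace is at most \<open>R\<close> times the sum of the squared entries. Hence
  \<open>N \<le> R (1 + N \<epsilon>\<^sup>2\<^sup>k)\<close>, and \<open>N \<le> 2 R\<close> as soon as \<open>R \<epsilon>\<^sup>2\<^sup>k \<le> 1/2\<close>.

  For \<open>x = 33 c\<^sup>2\<close> and \<open>k\<close> close to \<open>\<kappa> d\<close> with \<open>\<kappa> = x / (1 - x)\<close>, the bound on \<open>R \<epsilon>\<^sup>2\<^sup>k\<close> decays exponentially
  in \<open>d\<close> because \<open>\<epsilon>\<^sup>2 / x < 1/e\<close> (\<open>decay_rate\<close>), while the bound on \<open>R\<close> grows like the \<open>d\<close>-th power of a
  number smaller than \<open>1 + 3.75 c\<close> (\<open>growth_rate\<close>). The growth exponent has order \<open>c\<^sup>2 ln (1/c)\<close>, so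
  the linear bound is tightest at the right end of the range, where \<open>c\<close> is near \<open>0.02\<close>.
\<close>

section \<open>Nearly orthogonal unit vectors\<close>

text \<open>
  The \<open>k\<close>-th power of the inner product is itself an inner product, in the space of homogeneous
  polynomials of degree \<open>k\<close>. The list holds the feature maps. Its length is controlled through the
  generating function \<open>(1 - x)\<^sup>-\<^sup>d\<close> of the dimensions, which avoids estimates of binomial
  coefficients. Splitting off one coordinate by the binomial theorem multiplies this
  function by a geometric series.
\<close>

lemma power_sum_features:
  fixes x :: real
  assumes x: "0 < x" "x < 1"
  shows "\<exists>\<Phi> :: ((nat \<Rightarrow> real) \<Rightarrow> real) list.
           real (length \<Phi>) * x ^ k \<le> (1 / (1 - x)) ^ d \<and>
           (\<forall>u v. (\<Sum>i<d. u i * v i) ^ k = (\<Sum>\<phi>\<leftarrow>\<Phi>. \<phi> u * \<phi> v))"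
proof (induction d arbitrary: k)
  case 0
  show ?case
  proof (cases "k = 0")
    case True
    then show ?thesis by (intro exI[of _ "[\<lambda>u. 1]"]) simp
  next
    case False
    then show ?thesis by (intro exI[of _ "[]"]) simp
  qed
next
  case (Suc d)
  let ?P = "\<lambda>j (\<Psi> :: ((nat \<Rightarrow> real) \<Rightarrow> real) list). real (length \<Psi>) * x ^ j \<le> (1 / (1 - x)) ^ d \<and>
    (\<forall>u v. (\<Sum>i<d. u i * v i) ^ j = (\<Sum>\<phi>\<leftarrow>\<Psi>. \<phi> u * \<phi> v))"
  have "\<forall>j. \<exists>\<Psi>. ?P j \<Psi>" using Suc.IH by blast
  from choice[OF this] obtain \<Psi> :: "nat \<Rightarrow> ((nat \<Rightarrow> real) \<Rightarrow> real) list" where \<Psi>: "\<And>j. real (length (\<Psi> j)) * x ^ j \<le> (1 / (1 - x)) ^ d"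
    "\<And>j u v. (\<Sum>i<d. u i * v i) ^ j = (\<Sum>\<phi>\<leftarrow>\<Psi> j. \<phi> u * \<phi> v)"
    by blast
  define ext where "ext j = map (\<lambda>\<phi> u. sqrt (real (k choose j)) * \<phi> u * u d ^ (k - j)) (\<Psi> j)" for j
  define \<Phi> where "\<Phi> = concat (map ext [0..<Suc k])"
  have "real (length \<Phi>) * x ^ k = (\<Sum>j\<le>k. real (length (\<Psi> j)) * x ^ j * x ^ (k - j))"
  proof -
    have "length \<Phi> = (\<Sum>j\<le>k. length (\<Psi> j))"
      by (simp add: \<Phi>_def ext_def length_concat comp_def interv_sum_list_conv_sum_set_nat
          atLeast0AtMost atLeastLessThanSuc_atLeastAtMost del: upt_Suc)
    then show ?thesis
      by (simp add: sum_distrib_right mult.assoc flip: power_add)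
  qed
  also have "\<dots> \<le> (\<Sum>j\<le>k. (1 / (1 - x)) ^ d * x ^ (k - j))"
    using x by (intro sum_mono mult_right_mono \<Psi>) auto
  also have "\<dots> = (1 / (1 - x)) ^ d * (\<Sum>j\<le>k. x ^ j)"
    unfolding sum_distrib_left by (rule sum.reindex_bij_witness[of _ "\<lambda>i. k - i" "\<lambda>i. k - i"]) auto
  also have "\<dots> \<le> (1 / (1 - x)) ^ d * (1 / (1 - x))"
    using x by (intro mult_left_mono) (auto simp: sum_gp0 divide_right_mono)
  finally have 1: "real (length \<Phi>) * x ^ k \<le> (1 / (1 - x)) ^ Suc d"
    by simp
  have 2: "(\<Sum>i<Suc d. u i * v i) ^ k = (\<Sum>\<phi>\<leftarrow>\<Phi>. \<phi> u * \<phi> v)" for u v :: "nat \<Rightarrow> real"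
  proof -
    have e: "(\<Sum>\<phi>\<leftarrow>ext j. \<phi> u * \<phi> v) = real (k choose j) * (\<Sum>i<d. u i * v i) ^ j * (u d * v d) ^ (k - j)" for j
    proof -
      have "(\<Sum>\<phi>\<leftarrow>ext j. \<phi> u * \<phi> v) = 
          (\<Sum>\<phi>\<leftarrow>\<Psi> j. (sqrt (real (k choose j)) * sqrt (real (k choose j)) * (u d * v d) ^ (k - j)) * (\<phi> u * \<phi> v))"
        unfolding ext_def map_map comp_def power_mult_distrib
        by (intro arg_cong[of _ _ sum_list] map_cong refl) (simp only: mult_ac)
      then show ?thesis
        by (simp add: sum_list_const_mult \<Psi>(2))
    qed
    have c: "sum_list (map f (concat xss)) = sum_list (map (\<lambda>xs. sum_list (map f xs)) xss)"
      for f :: "((nat \<Rightarrow> real) \<Rightarrow> real) \<Rightarrow> real" and xss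
      by (induction xss) auto
    have "(\<Sum>\<phi>\<leftarrow>\<Phi>. \<phi> u * \<phi> v) = (\<Sum>j\<le>k. \<Sum>\<phi>\<leftarrow>ext j. \<phi> u * \<phi> v)"
      by (simp add: \<Phi>_def c comp_def interv_sum_list_conv_sum_set_nat
          atLeast0AtMost atLeastLessThanSuc_atLeastAtMost del: upt_Suc)
    also have "\<dots> = (\<Sum>i<Suc d. u i * v i) ^ k"
      by (simp add: e binomial_ring)
    finally show ?thesis ..
  qed
  show ?case using 1 2 by blast
qed

text \<open>
  For a Gram matrix \<open>K\<close> built from a matrix with columns indexed by the features, the
  smaller matrix \<open>M\<close> of inner products of these columns has the same trace and the same sum of
  squared entries. The Cauchy-Schwarz inequality on the diagonal of \<open>M\<close> gives the claim. This is the
  bound of the squared trace by rank times squared Frobenius norm, with no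
  spectral theory.
\<close>

lemma trace_squared_le:
  fixes \<Phi> :: "('a \<Rightarrow> real) list"
  defines "K \<equiv> \<lambda>u v. \<Sum>\<phi>\<leftarrow>\<Phi>. \<phi> u * \<phi> v"
  shows "(\<Sum>u\<in>S. K u u)\<^sup>2 \<le> real (length \<Phi>) * (\<Sum>u\<in>S. \<Sum>v\<in>S. (K u v)\<^sup>2)"
proof -
  define R where "R = length \<Phi>"
  define M where "M l m = (\<Sum>u\<in>S. (\<Phi> ! l) u * (\<Phi> ! m) u)" for l m
  have K: "K u v = (\<Sum>l<R. (\<Phi> ! l) u * (\<Phi> ! l) v)" for u v
    by (simp add: K_def sum_list_sum_nth R_def atLeast0LessThan)
  have "(\<Sum>u\<in>S. K u u) = (\<Sum>l<R. M l l)"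
    unfolding K M_def by (rule sum.swap)
  then have "(\<Sum>u\<in>S. K u u)\<^sup>2 \<le> R * (\<Sum>l<R. (M l l)\<^sup>2)"
    using Cauchy_Schwarz_ineq_sum[of "\<lambda>_. 1" "\<lambda>l. M l l" "{..<R}"] by simp
  also have "(\<Sum>l<R. (M l l)\<^sup>2) \<le> (\<Sum>l<R. \<Sum>m<R. (M l m)\<^sup>2)"
    by (intro sum_mono member_le_sum) auto
  also have "(\<Sum>l<R. \<Sum>m<R. (M l m)\<^sup>2) = (\<Sum>u\<in>S. \<Sum>v\<in>S. (K u v)\<^sup>2)"
  proof -
    have "(\<Sum>l<R. \<Sum>m<R. (M l m)\<^sup>2) =
      (\<Sum>l<R. \<Sum>m<R. \<Sum>u\<in>S. \<Sum>v\<in>S. (\<Phi> ! l) u * (\<Phi> ! l) v * ((\<Phi> ! m) u * (\<Phi> ! m) v))"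
      by (simp add: M_def power2_eq_square sum_product mult_ac)
    also have "\<dots> = (\<Sum>l<R. \<Sum>u\<in>S. \<Sum>v\<in>S. \<Sum>m<R. (\<Phi> ! l) u * (\<Phi> ! l) v * ((\<Phi> ! m) u * (\<Phi> ! m) v))"
      by (intro sum.cong refl) (subst sum.swap, intro sum.cong refl, rule sum.swap)
    also have "\<dots> = (\<Sum>u\<in>S. \<Sum>v\<in>S. \<Sum>l<R. \<Sum>m<R. (\<Phi> ! l) u * (\<Phi> ! l) v * ((\<Phi> ! m) u * (\<Phi> ! m) v))"
      by (subst sum.swap, intro sum.cong refl, rule sum.swap)
    also have "\<dots> = (\<Sum>u\<in>S. \<Sum>v\<in>S. (K u v)\<^sup>2)"
      by (simp add: K power2_eq_square sum_product)
    finally show ?thesis .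
  qed
  finally show ?thesis by (simp add: R_def mult_left_mono)
qed

text \<open>
  With \<open>N\<close> vectors and \<open>R\<close> features for the \<open>k\<close>-th power, the trace inequality reads
  \<open>N\<^sup>2 \<le> R N (1 + N \<epsilon>\<^sup>2\<^sup>k)\<close>. The condition on \<open>k\<close> makes the second term at most \<open>N / 2\<close> after division
  by \<open>N\<close>, so that it can be absorbed on the left.
\<close>

lemma card_nearly_orthogonal_le:
  fixes S :: "'a set" and w :: "'a \<Rightarrow> nat \<Rightarrow> real"
  assumes fin: "finite S" and x: "0 < x" "x < 1" and \<epsilon>: "0 \<le> \<epsilon>"
    and unit: "\<And>u. u \<in> S \<Longrightarrow> (\<Sum>i<d. w u i * w u i) = 1"
    and small: "\<And>u v. u \<in> S \<Longrightarrow> v \<in> S \<Longrightarrow> u \<noteq> v \<Longrightarrow> \<bar>\<Sum>i<d. w u i * w v i\<bar> \<le> \<epsilon>"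
    and k: "(\<epsilon>\<^sup>2 / x) ^ k * (1 / (1 - x)) ^ d \<le> 1 / 2"
  shows "real (card S) \<le> 2 * ((1 / x) ^ k * (1 / (1 - x)) ^ d)"
proof (cases "S = {}")
  case True
  then show ?thesis using x by simp
next
  case False
  define N where "N = real (card S)"
  have N: "N > 0" using False fin by (simp add: N_def card_gt_0_iff)
  obtain \<Phi> :: "((nat \<Rightarrow> real) \<Rightarrow> real) list" where
    len: "real (length \<Phi>) * x ^ k \<le> (1 / (1 - x)) ^ d" and
    \<Phi>: "\<And>u v. (\<Sum>i<d. u i * v i) ^ k = (\<Sum>\<phi>\<leftarrow>\<Phi>. \<phi> u * \<phi> v)"
    using power_sum_features[OF x, of k d] by blast
  define R where "R = real (length \<Phi>)"
  define B where "B u v = (\<Sum>i<d. w u i * w v i) ^ k" for u v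
  have R: "R \<le> (1 / x) ^ k * (1 / (1 - x)) ^ d"
    using len x by (simp add: R_def field_simps)
  have "N\<^sup>2 = (\<Sum>u\<in>S. B u u)\<^sup>2" by (simp add: B_def unit N_def)
  also have "\<dots> \<le> R * (\<Sum>u\<in>S. \<Sum>v\<in>S. (B u v)\<^sup>2)"
    using trace_squared_le[of "map (\<lambda>\<phi> u. \<phi> (w u)) \<Phi>" S]
    by (simp add: B_def \<Phi> R_def comp_def)
  also have "\<dots> \<le> R * (\<Sum>u\<in>S. 1 + N * \<epsilon> ^ (2 * k))"
  proof (intro mult_left_mono sum_mono)
    fix u assume u: "u \<in> S"
    have b: "(B u v)\<^sup>2 \<le> \<epsilon> ^ (2 * k)" if "v \<in> S - {u}" for v
    proof -
      have "\<bar>\<Sum>i<d. w u i * w v i\<bar> ^ (2 * k) \<le> \<epsilon> ^ (2 * k)"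
        using that u small by (intro power_mono) auto
      then show ?thesis by (simp add: B_def power_even_abs mult.commute flip: power_mult)
    qed
    have "(\<Sum>v\<in>S. (B u v)\<^sup>2) = (B u u)\<^sup>2 + (\<Sum>v\<in>S-{u}. (B u v)\<^sup>2)"
      using fin u by (simp add: sum.remove)
    also have "\<dots> \<le> 1 + (\<Sum>v\<in>S-{u}. \<epsilon> ^ (2 * k))"
      using u b by (intro add_mono sum_mono) (simp_all add: B_def unit)
    also have "\<dots> \<le> 1 + N * \<epsilon> ^ (2 * k)"
      using \<epsilon> fin u N by (simp add: N_def mult_right_mono card_Diff_singleton)
    finally show "(\<Sum>v\<in>S. (B u v)\<^sup>2) \<le> 1 + N * \<epsilon> ^ (2 * k)" .
  qed (simp add: R_def)
  also have "\<dots> = N * (R * (1 + N * \<epsilon> ^ (2 * k)))" by (simp add: N_def)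
  finally have "N \<le> R * (1 + N * \<epsilon> ^ (2 * k))"
    using N by (simp add: power2_eq_square)
  also have "\<dots> = R + N * (R * \<epsilon> ^ (2 * k))" by (simp add: algebra_simps)
  also have "R * \<epsilon> ^ (2 * k) \<le> 1 / 2"
  proof -
    have "R * \<epsilon> ^ (2 * k) \<le> (1 / x) ^ k * (1 / (1 - x)) ^ d * \<epsilon> ^ (2 * k)"
      using R \<epsilon> by (intro mult_right_mono) auto
    also have "\<dots> = (\<epsilon>\<^sup>2 / x) ^ k * (1 / (1 - x)) ^ d"
      by (simp add: power_divide power_mult)
    finally show ?thesis using k by simp
  qed
  finally show ?thesis using R N unfolding N_def[symmetric] by simp
qed

section \<open>A Ramsey argument for stars\<close>

lemma large_colour_class:
  assumes "finite B" "g ` B \<subseteq> {..<L}" "card B > L * n"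
  shows "\<exists>c<L. card {b\<in>B. g b = c} > n"
proof (rule ccontr)
  assume "\<not> ?thesis"
  then have "(\<Sum>c<L. card {b\<in>B. g b = c}) \<le> (\<Sum>c<L. n)"
    by (intro sum_mono) (meson lessThan_iff not_less)
  moreover have "(\<Sum>c<L. card {b\<in>B. g b = c}) = card B"
    using sum.group[of B "{..<L}" g "\<lambda>_. 1::nat"] assms by simp
  ultimately show False using assms by simp
qed

text \<open>
  The colour of a pair is determined by one of its ends. Think of \<open>P\<close> as enumerated in some order: \<open>col p\<close>
  is the colour of all pairs from \<open>p\<close> to the later points of \<open>P\<close> and to \<open>S\<close>. The order itself is left out.
\<close>

definition end_homogeneous :: "('a \<Rightarrow> 'a \<Rightarrow> nat) \<Rightarrow> 'a set \<Rightarrow> 'a set \<Rightarrow> ('a \<Rightarrow> nat) \<Rightarrow> bool" where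
  "end_homogeneous f P S col \<longleftrightarrow>
     (\<forall>p\<in>P. \<forall>s\<in>S. f p s = col p) \<and>
     (\<forall>p\<in>P. \<forall>q\<in>P. p \<noteq> q \<longrightarrow> f p q = col p \<or> f p q = col q)"

text \<open>
  Pick a point, keep the points of a large colour class at it, and repeat. Each round divides the
  number of remaining points by at most \<open>L + 1\<close>; the extra \<open>1\<close> pays for the removed point.
\<close>

lemma end_homogeneous_sets:
  fixes f :: "'a \<Rightarrow> 'a \<Rightarrow> nat"
  assumes sym: "\<And>x y. f x y = f y x" and L: "L > 0" and T: "T > 0"
    and "finite A" and "\<And>x y. x \<in> A \<Longrightarrow> y \<in> A \<Longrightarrow> x \<noteq> y \<Longrightarrow> f x y < L"
    and "card A \<ge> (L + 1) ^ M * T"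
  shows "\<exists>P S col. P \<subseteq> A \<and> S \<subseteq> A \<and> P \<inter> S = {} \<and> card P = M \<and> card S \<ge> T \<and>
           end_homogeneous f P S col"
  using assms(4-)
proof (induction M arbitrary: A)
  case 0
  then show ?case
    by - (rule exI[of _ "{}"], rule exI[of _ A], auto simp: end_homogeneous_def)
next
  case (Suc M)
  define Y where "Y = (L + 1) ^ M * T"
  have Y: "Y > 0" using T by (simp add: Y_def)
  have cA: "card A \<ge> (L + 1) * Y" using Suc.prems(3) by (simp add: Y_def mult_ac)
  then have "card A > 0" using Y by (metis add_is_0 gr_zeroI le_zero_eq mult_is_0 one_neq_zero not_gr_zero)
  then obtain x where x: "x \<in> A" by fastforce
  have "L * (Y - 1) < card (A - {x})"
  proof -
    have "card (A - {x}) \<ge> L * Y + Y - 1"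
      using cA x Suc.prems(1) by (simp add: card_Diff_singleton)
    moreover have "L * (Y - 1) < L * Y" using Y L by simp
    ultimately show ?thesis using Y by linarith
  qed
  moreover have "f x ` (A - {x}) \<subseteq> {..<L}" using Suc.prems(2) x by auto
  ultimately obtain c where c: "c < L" "card {y\<in>A-{x}. f x y = c} > Y - 1"
    using large_colour_class[of "A - {x}" "f x" L "Y - 1"] Suc.prems(1) by auto
  define A' where "A' = {y\<in>A-{x}. f x y = c}"
  have A': "A' \<subseteq> A - {x}" "\<And>y. y \<in> A' \<Longrightarrow> f x y = c" by (auto simp: A'_def)
  have "\<exists>P S col. P \<subseteq> A' \<and> S \<subseteq> A' \<and> P \<inter> S = {} \<and> card P = M \<and> card S \<ge> T \<and>
           end_homogeneous f P S col"
  proof (rule Suc.IH)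
    show "finite A'" using Suc.prems(1) by (simp add: A'_def)
    show "(L + 1) ^ M * T \<le> card A'" using c Y by (simp add: A'_def Y_def)
    show "f y z < L" if "y \<in> A'" "z \<in> A'" "y \<noteq> z" for y z
      using that A' Suc.prems(2) by blast
  qed
  then obtain P S col where *: "P \<subseteq> A'" "S \<subseteq> A'" "P \<inter> S = {}" "card P = M" "card S \<ge> T" and eh: "end_homogeneous f P S col" by blast
  have eh1: "f p s = col p" if "p \<in> P" "s \<in> S" for p s
    using eh that by (simp add: end_homogeneous_def)
  have eh2: "f p q = col p \<or> f p q = col q" if "p \<in> P" "q \<in> P" "p \<noteq> q" for p q
    using eh that by (simp add: end_homogeneous_def)
  have xP: "x \<notin> P" "x \<notin> S" using * A' by auto
  have finP: "finite P" using * A' Suc.prems(1) by (meson finite_Diff finite_subset)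
  show ?case
  proof (rule exI[of _ "insert x P"], rule exI[of _ S], rule exI[of _ "col(x := c)"], intro conjI)
    show "card (insert x P) = Suc M" using xP finP * by simp
    have fx: "f x q = c" if "q \<in> P \<union> S" for q using that * A' by blast
    have fx': "f q x = c" if "q \<in> P" for q using fx[of q] that sym by simp
    have "f p q = (col(x := c)) p \<or> f p q = (col(x := c)) q"
      if "p \<in> insert x P" "q \<in> insert x P" "p \<noteq> q" for p q
      using that xP eh2[of p q] fx[of q] fx'[of p] by auto
    moreover have "f p s = (col(x := c)) p" if "p \<in> insert x P" "s \<in> S" for p s
      using that xP eh1[of p s] fx[of s] by auto
    ultimately show "end_homogeneous f (insert x P) S (col(x := c))"
      unfolding end_homogeneous_def by blast
  qed (use * A' x xP in auto)
qed

text \<open>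
  Among \<open>L m\<close> points of \<open>P\<close>, some value of \<open>col\<close> is taken \<open>m\<close> times. In contrast to the symmetric
  Ramsey theorem, the set \<open>S\<close> keeps a constant proportion of all points.
\<close>

lemma homogeneous_sets:
  fixes f :: "'a \<Rightarrow> 'a \<Rightarrow> nat"
  assumes sym: "\<And>x y. f x y = f y x" and L: "L > 0" and T: "T > 0" and m: "m > 0"
    and A: "finite A" and less: "\<And>x y. x \<in> A \<Longrightarrow> y \<in> A \<Longrightarrow> x \<noteq> y \<Longrightarrow> f x y < L"
    and card: "card A \<ge> (L + 1) ^ (L * m) * T"
  shows "\<exists>P S c. P \<subseteq> A \<and> S \<subseteq> A \<and> P \<inter> S = {} \<and> card P \<ge> m \<and> card S \<ge> T \<and>
           (\<forall>p\<in>P. \<forall>q\<in>P \<union> S. p \<noteq> q \<longrightarrow> f p q = c)"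
proof -
  obtain P S col where *: "P \<subseteq> A" "S \<subseteq> A" "P \<inter> S = {}" "card P = L * m" "card S \<ge> T" and eh: "end_homogeneous f P S col"
    using end_homogeneous_sets[where f = f and L = L and T = T and A = A and M = "L * m", OF sym L T A less card]
    by blast
  have eh1: "f p s = col p" if "p \<in> P" "s \<in> S" for p s
    using eh that by (simp add: end_homogeneous_def)
  have eh2: "f p q = col p \<or> f p q = col q" if "p \<in> P" "q \<in> P" "p \<noteq> q" for p q
    using eh that by (simp add: end_homogeneous_def)
  obtain s where s: "s \<in> S" using *(5) T by fastforce
  have "col ` P \<subseteq> {..<L}"
  proof safe
    fix p assume p: "p \<in> P"
    then have "p \<noteq> s" "p \<in> A" "s \<in> A" using s * by auto
    with less[of p s] eh1[OF p s] show "col p < L" by simp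
  qed
  moreover have "finite P" using * A finite_subset by blast
  moreover have "L * (m - 1) < card P" using * L m by simp
  ultimately obtain c where c: "card {p\<in>P. col p = c} > m - 1"
    using large_colour_class by blast
  show ?thesis
  proof (rule exI[of _ "{p\<in>P. col p = c}"], rule exI[of _ S], rule exI[of _ c], intro conjI)
    show "m \<le> card {p\<in>P. col p = c}" using c by linarith
    have "f p q = c" if "p \<in> P" "col p = c" "q \<in> {p\<in>P. col p = c} \<union> S" "p \<noteq> q" for p q
      using eh1[of p q] eh2[of p q] that by auto
    then show "\<forall>p\<in>{p\<in>P. col p = c}. \<forall>q\<in>{p\<in>P. col p = c} \<union> S. p \<noteq> q \<longrightarrow> f p q = c"
      by blast
  qed (use *(1-3,5) in auto)
qed

section \<open>Metrics with narrow angles\<close>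

text \<open>
  Adding the two law-of-cosines inequalities cancels \<open>a\<^sup>2\<close> and \<open>b\<^sup>2\<close> and leaves \<open>0 < 2 t (t - g (a + b))\<close>.
\<close>

lemma sum_of_sides_less:
  fixes a b t g :: real
  assumes "t > 0" and "a\<^sup>2 < t\<^sup>2 + b\<^sup>2 - 2 * g * (t * b)" and "b\<^sup>2 < t\<^sup>2 + a\<^sup>2 - 2 * g * (t * a)"
  shows "g * (a + b) < t"
proof -
  have "0 < 2 * t * (t - g * (a + b))" using assms by (simp add: algebra_simps power2_eq_square)
  then show ?thesis using assms(1) by (simp add: zero_less_mult_iff)
qed

text \<open>
  The angle hypothesis in terms of distances alone: by the law of cosines, the second part says that
  every angle has cosine larger than \<open>g\<close>.
\<close>

definition narrow_angles :: "real \<Rightarrow> ('a \<Rightarrow> 'a \<Rightarrow> real) \<Rightarrow> 'a set \<Rightarrow> bool" where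
  "narrow_angles g D A \<longleftrightarrow>
     (\<forall>x\<in>A. \<forall>y\<in>A. x \<noteq> y \<longrightarrow> D x y > 0) \<and>
     (\<forall>x\<in>A. \<forall>y\<in>A. \<forall>z\<in>A. x \<noteq> y \<and> y \<noteq> z \<and> x \<noteq> z \<longrightarrow>
        (D x z)\<^sup>2 < (D x y)\<^sup>2 + (D y z)\<^sup>2 - 2 * g * (D x y * D y z))"

context
  fixes g :: real and D :: "'a \<Rightarrow> 'a \<Rightarrow> real" and A :: "'a set"
  assumes g: "0 < g" "g \<le> 1" and sym: "\<And>x y. D x y = D y x"
    and nar: "narrow_angles g D A"
begin

lemma narrow_pos: "x \<in> A \<Longrightarrow> y \<in> A \<Longrightarrow> x \<noteq> y \<Longrightarrow> D x y > 0"
  using nar by (auto simp: narrow_angles_def)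

lemma narrow_cosine:
  "x \<in> A \<Longrightarrow> y \<in> A \<Longrightarrow> z \<in> A \<Longrightarrow> x \<noteq> y \<Longrightarrow> y \<noteq> z \<Longrightarrow> x \<noteq> z \<Longrightarrow>
     (D x z)\<^sup>2 < (D x y)\<^sup>2 + (D y z)\<^sup>2 - 2 * g * (D x y * D y z)"
  using nar by (auto simp: narrow_angles_def)

lemma narrow_sides:
  assumes "x \<in> A" "y \<in> A" "z \<in> A" "x \<noteq> y" "y \<noteq> z" "x \<noteq> z"
  shows "g * (D x y + D y z) < D x z"
proof (rule sum_of_sides_less)
  show "0 < D x z" using narrow_pos assms by auto
  show "(D x y)\<^sup>2 < (D x z)\<^sup>2 + (D y z)\<^sup>2 - 2 * g * (D x z * D y z)"
    using narrow_cosine[of x z y] assms sym[of z y] by simp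
  show "(D y z)\<^sup>2 < (D x z)\<^sup>2 + (D x y)\<^sup>2 - 2 * g * (D x z * D x y)"
    using narrow_cosine[of y x z] assms sym[of y x] by (simp add: mult_ac add_ac)
qed

lemma narrow_ratio_adjacent:
  assumes "x \<in> A" "y \<in> A" "z \<in> A" "x \<noteq> y" "x \<noteq> z"
  shows "g * D x y \<le> D x z"
proof (cases "y = z")
  case True
  then show ?thesis using narrow_pos[of x z] assms g by simp
next
  case False
  have "g * D x y \<le> g * (D x y + D y z)"
    using narrow_pos[of y z] assms g False by simp
  also have "\<dots> < D x z" using narrow_sides assms False by auto
  finally show ?thesis by simp
qed

text \<open>
  Two pairs are linked through a pair that shares a point with each of them, and every link
  costs one factor \<open>g\<close>.
\<close>

lemma narrow_ratio:
  assumes "x \<in> A" "y \<in> A" "a \<in> A" "b \<in> A" "x \<noteq> y" "a \<noteq> b"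
  shows "g\<^sup>2 * D x y \<le> D a b"
proof -
  consider "x \<noteq> a" | "x = a" by blast
  then have "\<exists>t. g * D x y \<le> t \<and> g * t \<le> D a b"
  proof cases
    case 1
    then show ?thesis using narrow_ratio_adjacent[of x y a] narrow_ratio_adjacent[of a x b] assms
      by (intro exI[of _ "D x a"]) (auto simp: sym)
  next
    case 2
    have "g * D a b \<le> D a b" using g narrow_pos[of a b] assms by simp
    then show ?thesis using narrow_ratio_adjacent[of x y b] 2 assms by auto
  qed
  then obtain t where "g * D x y \<le> t" "g * t \<le> D a b" by blast
  then have "g * (g * D x y) \<le> D a b" using g by (meson mult_left_mono order_trans less_imp_le)
  then show ?thesis by (simp add: power2_eq_square mult_ac)
qed

end

text \<open>
  The squared distances lie in an interval whose ends have ratio \<open>g\<^sup>-\<^sup>8\<close>. Cutting it into pieces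
  with ratio \<open>1 + \<delta>\<close> gives a number of colours that depends on \<open>g\<close> and \<open>\<delta>\<close> only. In particular \<open>K\<close> does
  not depend on the metric, hence not on the dimension.
\<close>

lemma nearly_equilateral_subsets:
  fixes g \<delta> :: real and m :: nat
  assumes g: "0 < g" "g \<le> 1" and \<delta>: "\<delta> > 0" and m: "m > 0"
  shows "\<exists>K>0. \<forall>(D :: 'a \<Rightarrow> 'a \<Rightarrow> real) A T. (\<forall>x y. D x y = D y x) \<longrightarrow> narrow_angles g D A \<longrightarrow> finite A \<longrightarrow>
            T > 0 \<longrightarrow> card A \<ge> K * T \<longrightarrow>
           (\<exists>P S r. P \<subseteq> A \<and> S \<subseteq> A \<and> P \<inter> S = {} \<and> card P \<ge> m \<and> card S \<ge> T \<and> r > 0 \<and>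
              (\<forall>p\<in>P. \<forall>q\<in>P \<union> S. p \<noteq> q \<longrightarrow> (D p q)\<^sup>2 \<in> {r..(1 + \<delta>) * r}))"
proof -
  define b where "b = 1 + \<delta>"
  have b: "b > 1" using \<delta> by (simp add: b_def)
  define L where "L = nat \<lfloor>log b (1 / g ^ 8)\<rfloor> + 1"
  define K where "K = (L + 1) ^ (L * m)"
  have L: "L > 0" by (simp add: L_def)
  have "K > 1" unfolding K_def using L m by (intro one_less_power) auto
  show ?thesis
  proof (intro exI[of _ K] conjI allI impI)
    show "K > 0" using \<open>K > 1\<close> by simp
    fix D :: "'a \<Rightarrow> 'a \<Rightarrow> real" and A T
    assume sym0: "\<forall>x y. D x y = D y x" and nar: "narrow_angles g D A"
      and fin: "finite A" and T: "T > 0" and card: "K * T \<le> card A"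
    have sym: "D x y = D y x" for x y using sym0 by blast
    have "1 < K * T" using \<open>K > 1\<close> T by (metis Suc_leI less_le_trans mult.right_neutral mult_le_mono2 One_nat_def)
    then have "card A \<ge> 2" using card by simp
    then obtain B where "B \<subseteq> A" "card B = 2" by (meson obtain_subset_with_card_n)
    then obtain u v where uv: "u \<in> A" "v \<in> A" "u \<noteq> v" by (auto simp: card_2_iff)
    \<comment> \<open>By the comparison of distances, \<open>e\<close> is a lower bound and \<open>e / g ^ 8\<close> an upper bound
      for all squared distances in \<open>A\<close>.\<close>
    define e where "e = g ^ 4 * (D u v)\<^sup>2"
    have Duv: "D u v > 0" using narrow_pos[OF g sym nar] uv by blast
    have e: "e > 0" using Duv g by (simp add: e_def)
    define f where "f x y = nat \<lfloor>log b ((D x y)\<^sup>2 / e)\<rfloor>" for x y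
    have rng: "1 \<le> (D x y)\<^sup>2 / e" "(D x y)\<^sup>2 / e \<le> 1 / g ^ 8" if "x \<in> A" "y \<in> A" "x \<noteq> y" for x y
    proof -
      have pos: "D x y > 0" using narrow_pos[OF g sym nar] that by blast
      have "(g\<^sup>2 * D u v)\<^sup>2 \<le> (D x y)\<^sup>2"
        using narrow_ratio[OF g sym nar, of u v x y] that uv Duv g by (intro power_mono) auto
      then show "1 \<le> (D x y)\<^sup>2 / e" using e by (simp add: e_def power_mult_distrib field_simps flip: power_mult)
      have "(g\<^sup>2 * D x y)\<^sup>2 \<le> (D u v)\<^sup>2"
        using narrow_ratio[OF g sym nar, of x y u v] that uv pos g by (intro power_mono) auto
      then have "g ^ 4 * (g\<^sup>2 * D x y)\<^sup>2 \<le> e" using g by (simp add: e_def)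
      then have "g ^ 8 * (D x y)\<^sup>2 \<le> e" by (simp add: power_mult_distrib flip: power_mult power_add mult.assoc)
      then show "(D x y)\<^sup>2 / e \<le> 1 / g ^ 8" using e g by (simp add: field_simps)
    qed
    have less: "f x y < L" if "x \<in> A" "y \<in> A" "x \<noteq> y" for x y
    proof -
      have "log b ((D x y)\<^sup>2 / e) \<le> log b (1 / g ^ 8)"
        using rng[OF that] b by (intro log_mono) auto
      then show ?thesis unfolding f_def L_def using nat_mono floor_mono by (metis less_Suc_eq_le Suc_eq_plus1)
    qed
    have fsym: "f x y = f y x" for x y by (simp add: f_def sym)
    obtain P S c where *: "P \<subseteq> A" "S \<subseteq> A" "P \<inter> S = {}" "card P \<ge> m" "card S \<ge> T"
      and mono: "\<forall>p\<in>P. \<forall>q\<in>P \<union> S. p \<noteq> q \<longrightarrow> f p q = c"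
      using homogeneous_sets[where f = f and A = A, OF fsym L T m fin less card[unfolded K_def]] by blast
    have "e * b ^ c \<le> (D p q)\<^sup>2 \<and> (D p q)\<^sup>2 \<le> (1 + \<delta>) * (e * b ^ c)"
      if "p \<in> P" "q \<in> P \<union> S" "p \<noteq> q" for p q
    proof -
      have pq: "p \<in> A" "q \<in> A" using that * by auto
      have "f p q = c" using that mono by blast
      moreover have "log b ((D p q)\<^sup>2 / e) \<ge> 0" using rng(1)[OF pq that(3)] b by simp
      ultimately have "real c \<le> log b ((D p q)\<^sup>2 / e)" "log b ((D p q)\<^sup>2 / e) < real c + 1"
        unfolding f_def by linarith+
      moreover have "(D p q)\<^sup>2 / e > 0" using rng(1)[OF pq that(3)] by simp
      ultimately have "b powr real c \<le> (D p q)\<^sup>2 / e" "(D p q)\<^sup>2 / e < b powr (real c + 1)"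
        using b by (simp_all add: le_log_iff log_less_iff)
      then show ?thesis using b e by (simp add: powr_add powr_realpow field_simps b_def)
    qed
    moreover have "e * b ^ c > 0" using e b by simp
    ultimately show "\<exists>P S r. P \<subseteq> A \<and> S \<subseteq> A \<and> P \<inter> S = {} \<and> card P \<ge> m \<and> card S \<ge> T \<and> r > 0 \<and>
              (\<forall>p\<in>P. \<forall>q\<in>P \<union> S. p \<noteq> q \<longrightarrow> (D p q)\<^sup>2 \<in> {r..(1 + \<delta>) * r})"
      using *(1-5) by - (rule exI[of _ P], rule exI[of _ S], rule exI[of _ "e * b ^ c"], auto)
  qed
qed

section \<open>Euclidean geometry around the centroid\<close>

definition eucl_dist :: "nat \<Rightarrow> (nat \<Rightarrow> real) \<Rightarrow> (nat \<Rightarrow> real) \<Rightarrow> real" where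
  "eucl_dist d x y = L2_set (\<lambda>i. x i - y i) {..<d}"

lemma eucl_dist_commute: "eucl_dist d x y = eucl_dist d y x"
  by (simp add: eucl_dist_def L2_set_def power2_commute)

lemma eucl_dist_squared: "(eucl_dist d x y)\<^sup>2 = (\<Sum>i<d. (x i - y i)\<^sup>2)"
  by (simp add: eucl_dist_def L2_set_def sum_nonneg)

lemma eucl_dist_pos:
  assumes "x \<in> topspace (Euclidean_space d)" "y \<in> topspace (Euclidean_space d)" "x \<noteq> y"
  shows "eucl_dist d x y > 0"
proof -
  obtain i where i: "x i \<noteq> y i" using assms(3) by blast
  have "i < d" using assms(1,2) i by (simp add: topspace_Euclidean_space) (metis not_le)
  then have "eucl_dist d x y \<noteq> 0"
    using i by (auto simp: eucl_dist_def L2_set_eq_0_iff)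
  then show ?thesis by (simp add: eucl_dist_def less_le L2_set_nonneg)
qed

lemma law_of_cosines:
  "(eucl_dist d x z)\<^sup>2 =
     (eucl_dist d x y)\<^sup>2 + (eucl_dist d y z)\<^sup>2 - 2 * (\<Sum>i<d. (x i - y i) * (z i - y i))"
  unfolding eucl_dist_squared sum_distrib_left sum.distrib[symmetric] sum_subtractf[symmetric]
  by (intro sum.cong refl) (simp add: power2_eq_square algebra_simps)

lemma angles_below_subset:
  assumes "angles_below \<alpha> d A" "B \<subseteq> A"
  shows "angles_below \<alpha> d B"
proof -
  have "x \<in> A" if "x \<in> B" for x using assms(2) that by blast
  then show ?thesis using assms(1) by (auto simp: angles_below_def)
qed

text \<open>
  The Cauchy-Schwarz inequality puts the quotient inside the arc cosine into \<open>[-1, 1]\<close>, so that taking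
  cosines inverts the arc cosine and reverses the inequality.
\<close>

lemma angles_below_narrow:
  assumes A: "angles_below \<alpha> d A" and \<alpha>: "0 \<le> \<alpha>" "\<alpha> \<le> pi"
  shows "narrow_angles (cos \<alpha>) (eucl_dist d) A"
  unfolding narrow_angles_def
proof (intro conjI ballI impI)
  have top: "x \<in> topspace (Euclidean_space d)" if "x \<in> A" for x
    using A that by (auto simp: angles_below_def)
  show pos: "eucl_dist d x y > 0" if "x \<in> A" "y \<in> A" "x \<noteq> y" for x y
    using that top eucl_dist_pos by blast
  fix x y z assume xyz: "x \<in> A" "y \<in> A" "z \<in> A" "x \<noteq> y \<and> y \<noteq> z \<and> x \<noteq> z"
  define I where "I = (\<Sum>i<d. (x i - y i) * (z i - y i))"
  define Q where "Q = eucl_dist d x y * eucl_dist d y z"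
  have Q: "Q > 0" using pos xyz by (simp add: Q_def)
  have Q_eq: "Q = L2_set (\<lambda>i. x i - y i) {..<d} * L2_set (\<lambda>i. z i - y i) {..<d}"
    unfolding Q_def eucl_dist_commute[of d y z] by (simp add: eucl_dist_def)
  have "\<bar>I\<bar> \<le> (\<Sum>i<d. \<bar>x i - y i\<bar> * \<bar>z i - y i\<bar>)"
    unfolding I_def by (rule order_trans[OF sum_abs]) (simp add: abs_mult)
  also have "\<dots> \<le> Q" unfolding Q_eq by (rule L2_set_mult_ineq)
  finally have bd: "-1 \<le> I / Q" "I / Q \<le> 1" using Q by (auto simp: field_simps abs_le_iff)
  have "arccos (I / Q) < \<alpha>"
    using A xyz by (auto simp: angles_below_def angle_at_def I_def Q_eq)
  then have "cos \<alpha> < cos (arccos (I / Q))"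
    using arccos_lbound[OF bd] \<alpha> by (intro cos_monotone_0_pi)
  then have "cos \<alpha> * Q < I" using bd Q by (simp add: pos_less_divide_eq)
  then show "(eucl_dist d x z)\<^sup>2 <
     (eucl_dist d x y)\<^sup>2 + (eucl_dist d y z)\<^sup>2 - 2 * cos \<alpha> * (eucl_dist d x y * eucl_dist d y z)"
    unfolding law_of_cosines[of d x z y] I_def[symmetric] Q_def[symmetric] by simp
qed

definition centroid :: "(nat \<Rightarrow> real) set \<Rightarrow> nat \<Rightarrow> real" where
  "centroid P i = (\<Sum>p\<in>P. p i) / real (card P)"

text \<open>
  Inner products with respect to the centroid are determined by distances. In every coordinate
  this is an identity between the first two power sums of the coordinates of the points of \<open>P\<close>.
\<close>

lemma inner_from_centroid:
  fixes P :: "(nat \<Rightarrow> real) set"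
  assumes P: "finite P" "P \<noteq> {}"
  defines "m \<equiv> real (card P)"
  shows "(\<Sum>i<d. (x i - centroid P i) * (y i - centroid P i)) =
     ((\<Sum>p\<in>P. (eucl_dist d p x)\<^sup>2) / m + (\<Sum>p\<in>P. (eucl_dist d p y)\<^sup>2) / m - (eucl_dist d x y)\<^sup>2
       - (\<Sum>p\<in>P. \<Sum>q\<in>P. (eucl_dist d p q)\<^sup>2) / m\<^sup>2) / 2"
proof -
  have m: "m > 0" using P by (simp add: m_def card_gt_0_iff)
  have coord: "(x i - centroid P i) * (y i - centroid P i) =
     ((\<Sum>p\<in>P. (p i - x i)\<^sup>2) / m + (\<Sum>p\<in>P. (p i - y i)\<^sup>2) / m - (x i - y i)\<^sup>2
       - (\<Sum>p\<in>P. \<Sum>q\<in>P. (p i - q i)\<^sup>2) / m\<^sup>2) / 2" for i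
  proof -
    define s where "s = (\<Sum>p\<in>P. p i)"
    define t where "t = (\<Sum>p\<in>P. (p i)\<^sup>2)"
    have one: "(\<Sum>p\<in>P. (p i - a)\<^sup>2) = t - 2 * a * s + m * a\<^sup>2" for a
      unfolding power2_diff sum.distrib sum_subtractf
      by (simp add: s_def t_def m_def mult.commute mult.left_commute flip: sum_distrib_left sum_distrib_right)
    have two: "(\<Sum>p\<in>P. \<Sum>q\<in>P. (p i - q i)\<^sup>2) = 2 * m * t - 2 * s\<^sup>2"
    proof -
      have "(\<Sum>p\<in>P. \<Sum>q\<in>P. (p i - q i)\<^sup>2) = (\<Sum>q\<in>P. \<Sum>p\<in>P. (p i - q i)\<^sup>2)"
        by (rule sum.swap)
      also have "\<dots> = m * t - 2 * s * s + m * t"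
        unfolding one sum.distrib sum_subtractf
        by (simp add: s_def t_def m_def mult.commute flip: sum_distrib_left sum_distrib_right)
      finally show ?thesis by (simp add: power2_eq_square)
    qed
    have c: "centroid P i = s / m" by (simp add: centroid_def s_def m_def)
    show ?thesis unfolding one two c using m by (simp add: field_simps power2_eq_square)
  qed
  have single: "(\<Sum>i<d. \<Sum>p\<in>P. (p i - z i)\<^sup>2) = (\<Sum>p\<in>P. (eucl_dist d p z)\<^sup>2)" for z
    unfolding eucl_dist_squared by (rule sum.swap)
  have double: "(\<Sum>i<d. \<Sum>p\<in>P. \<Sum>q\<in>P. (p i - q i)\<^sup>2) = (\<Sum>p\<in>P. \<Sum>q\<in>P. (eucl_dist d p q)\<^sup>2)"
    unfolding eucl_dist_squared by (subst sum.swap, intro sum.cong refl, rule sum.swap)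
  show ?thesis
    unfolding coord sum_divide_distrib[symmetric] sum_subtractf sum.distrib single double
      eucl_dist_squared[of d x y] ..
qed

text \<open>
  Every term of the distance formula for the inner product is known up to a factor \<open>1 + \<delta>\<close>: the two
  averages are about \<open>r\<close>, and so is the double average over \<open>P\<close>, where the zero terms on the diagonal cost a
  proportion \<open>1 / card P \<le> \<delta>\<close>. For distinct \<open>x\<close> and \<open>y\<close> the squared distance is estimated in the
  triangle that they form with a point \<open>p\<close> of \<open>P\<close>: from below by \<open>narrow_sides\<close>, from above by the law of
  cosines at \<open>p\<close>.
\<close>

lemma centred_inner_bounds:
  fixes P S :: "(nat \<Rightarrow> real) set"
  assumes g: "0 < g" "g \<le> 1" and \<delta>: "\<delta> > 0" and r: "r > 0"
    and nar: "narrow_angles g (eucl_dist d) (P \<union> S)" and disj: "P \<inter> S = {}"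
    and P: "finite P" "1 / \<delta> \<le> real (card P)"
    and near: "\<forall>p\<in>P. \<forall>q\<in>P \<union> S. p \<noteq> q \<longrightarrow> (eucl_dist d p q)\<^sup>2 \<in> {r..(1 + \<delta>) * r}"
    and xy: "x \<in> S" "y \<in> S"
  defines "I \<equiv> \<Sum>i<d. (x i - centroid P i) * (y i - centroid P i)"
  shows "x = y \<Longrightarrow> (1 - \<delta>) * r / 2 \<le> I"
    and "x \<noteq> y \<Longrightarrow> I \<le> (1 - 4 * g\<^sup>2 + 3 * \<delta>) * r / 2"
    and "x \<noteq> y \<Longrightarrow> (2 * g - 1 - 3 * \<delta>) * r / 2 \<le> I"
proof -
  define m where "m = real (card P)"
  have "0 < 1 / \<delta>" using \<delta> by simp
  then have m: "m > 0" "1 \<le> \<delta> * m"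
    using P(2) \<delta> unfolding m_def by (linarith, simp add: pos_divide_le_eq mult.commute)
  then have ne: "P \<noteq> {}" by (auto simp: m_def)
  obtain p where p: "p \<in> P" using ne by blast
  define a where "a z = (\<Sum>p\<in>P. (eucl_dist d p z)\<^sup>2) / m" for z
  define e where "e = (\<Sum>p\<in>P. \<Sum>q\<in>P. (eucl_dist d p q)\<^sup>2) / m\<^sup>2"
  have I: "I = (a x + a y - (eucl_dist d x y)\<^sup>2 - e) / 2"
    unfolding I_def inner_from_centroid[OF P(1) ne] a_def e_def m_def ..
  have nearD: "(eucl_dist d p q)\<^sup>2 \<in> {r..(1 + \<delta>) * r}" if "p \<in> P" "q \<in> P \<union> S" "p \<noteq> q" for p q
    using near[rule_format, OF that] .
  have near': "(eucl_dist d p z)\<^sup>2 \<in> {r..(1 + \<delta>) * r}" if "p \<in> P" "z \<in> S" for p z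
    using nearD[of p z] that disj by blast
  have a: "r \<le> a z" "a z \<le> (1 + \<delta>) * r" if "z \<in> S" for z
  proof -
    have "(\<Sum>p\<in>P. r) \<le> (\<Sum>p\<in>P. (eucl_dist d p z)\<^sup>2)"
      using near' that by (intro sum_mono) auto
    then show "r \<le> a z" using m by (simp add: a_def m_def field_simps)
    have "(\<Sum>p\<in>P. (eucl_dist d p z)\<^sup>2) \<le> (\<Sum>p\<in>P. (1 + \<delta>) * r)"
      using near' that by (intro sum_mono) auto
    then show "a z \<le> (1 + \<delta>) * r" using m by (simp add: a_def m_def field_simps)
  qed
  have row: "(m - 1) * r \<le> (\<Sum>q\<in>P. (eucl_dist d p q)\<^sup>2)"
    "(\<Sum>q\<in>P. (eucl_dist d p q)\<^sup>2) \<le> m * ((1 + \<delta>) * r)" if "p \<in> P" for p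
  proof -
    have eq: "(\<Sum>q\<in>P. (eucl_dist d p q)\<^sup>2) = (\<Sum>q\<in>P-{p}. (eucl_dist d p q)\<^sup>2)"
      using P(1) that by (simp add: sum.remove eucl_dist_squared)
    have card: "real (card (P - {p})) = m - 1"
      using P(1) that ne by (simp add: m_def card_Diff_singleton of_nat_diff Suc_leI card_gt_0_iff)
    have "(\<Sum>q\<in>P-{p}. r) \<le> (\<Sum>q\<in>P-{p}. (eucl_dist d p q)\<^sup>2)"
      using nearD[of p] that by (intro sum_mono) auto
    then show "(m - 1) * r \<le> (\<Sum>q\<in>P. (eucl_dist d p q)\<^sup>2)" using eq card by simp
    have "(\<Sum>q\<in>P-{p}. (eucl_dist d p q)\<^sup>2) \<le> (\<Sum>q\<in>P-{p}. (1 + \<delta>) * r)"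
      using nearD[of p] that by (intro sum_mono) auto
    also have "\<dots> = (m - 1) * ((1 + \<delta>) * r)" using card by simp
    also have "\<dots> \<le> m * ((1 + \<delta>) * r)" using \<delta> r by (intro mult_right_mono) auto
    finally show "(\<Sum>q\<in>P. (eucl_dist d p q)\<^sup>2) \<le> m * ((1 + \<delta>) * r)" using eq by simp
  qed
  have e: "(1 - \<delta>) * r \<le> e" "e \<le> (1 + \<delta>) * r"
  proof -
    have "m * ((m - 1) * r) \<le> (\<Sum>p\<in>P. \<Sum>q\<in>P. (eucl_dist d p q)\<^sup>2)"
      using sum_mono[OF row(1), of P] by (simp add: m_def)
    moreover have "(1 - \<delta>) * r * m\<^sup>2 \<le> m * ((m - 1) * r)"
    proof -
      have "0 \<le> m * r * (\<delta> * m - 1)" using m r by simp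
      then show ?thesis by (simp add: algebra_simps power2_eq_square)
    qed
    ultimately show "(1 - \<delta>) * r \<le> e" using m by (simp add: e_def pos_le_divide_eq)
    have "(\<Sum>p\<in>P. \<Sum>q\<in>P. (eucl_dist d p q)\<^sup>2) \<le> m * (m * ((1 + \<delta>) * r))"
      using sum_mono[OF row(2), of P] by (simp add: m_def)
    then show "e \<le> (1 + \<delta>) * r" using m by (simp add: e_def pos_divide_le_eq power2_eq_square mult_ac)
  qed
  define U where "U = (1 + \<delta>) * r"
  define V where "V = (1 - \<delta>) * r"
  note ax = a[OF xy(1), folded U_def] and ay = a[OF xy(2), folded U_def]
  note eUV = e[folded U_def V_def]
  have "V = 2 * r - U" by (simp add: U_def V_def algebra_simps)
  then show "(1 - \<delta>) * r / 2 \<le> I" if "x = y"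
    using ax(1) ay(1) eUV(2) that unfolding I V_def[symmetric]
    by (simp add: eucl_dist_squared)
  assume "x \<noteq> y"
  have mem: "p \<in> P \<union> S" "x \<in> P \<union> S" "y \<in> P \<union> S" "p \<noteq> x" "p \<noteq> y"
    using p xy disj by auto
  note n = near'[OF p xy(1)] near'[OF p xy(2)]
  have pos: "eucl_dist d p x > 0" "eucl_dist d p y > 0"
    using narrow_pos[OF g eucl_dist_commute nar] mem by auto
  have sq: "sqrt r \<le> eucl_dist d p x" "sqrt r \<le> eucl_dist d p y"
    using n pos by (auto intro!: real_le_lsqrt)
  have lower: "4 * g\<^sup>2 * r \<le> (eucl_dist d x y)\<^sup>2"
  proof -
    have "g * (eucl_dist d x p + eucl_dist d p y) < eucl_dist d x y"
      using narrow_sides[OF g eucl_dist_commute nar, of x p y] mem \<open>x \<noteq> y\<close> by auto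
    moreover have "g * (2 * sqrt r) \<le> g * (eucl_dist d x p + eucl_dist d p y)"
      using sq g by (intro mult_left_mono) (auto simp: eucl_dist_commute[of d x p])
    ultimately have "2 * g * sqrt r \<le> eucl_dist d x y" by (simp add: mult_ac)
    then have "(2 * g * sqrt r)\<^sup>2 \<le> (eucl_dist d x y)\<^sup>2"
      using g r by (intro power_mono) auto
    then show ?thesis using r by (simp add: power_mult_distrib)
  qed
  have upper: "(eucl_dist d x y)\<^sup>2 \<le> (2 + 2 * \<delta> - 2 * g) * r"
  proof -
    have "(eucl_dist d x y)\<^sup>2 \<le> (eucl_dist d x p)\<^sup>2 + (eucl_dist d p y)\<^sup>2
        - 2 * g * (eucl_dist d x p * eucl_dist d p y)"
      using narrow_cosine[OF g eucl_dist_commute nar, of x p y] mem \<open>x \<noteq> y\<close> by auto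
    moreover have "sqrt r * sqrt r \<le> eucl_dist d x p * eucl_dist d p y"
      using sq r pos by (intro mult_mono) (auto simp: eucl_dist_commute[of d x p])
    then have "2 * g * r \<le> 2 * g * (eucl_dist d x p * eucl_dist d p y)"
      using g r by simp
    ultimately show ?thesis using n by (simp add: eucl_dist_commute[of d x p] algebra_simps)
  qed
  have "(1 - 4 * g\<^sup>2 + 3 * \<delta>) * r / 2 = (2 * U - 4 * g\<^sup>2 * r - V) / 2"
    by (simp add: U_def V_def algebra_simps)
  then show "I \<le> (1 - 4 * g\<^sup>2 + 3 * \<delta>) * r / 2"
    using ax(2) ay(2) eUV(1) lower unfolding I by simp
  have "(2 * g - 1 - 3 * \<delta>) * r / 2 = (2 * r - (2 + 2 * \<delta> - 2 * g) * r - U) / 2"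
    by (simp add: U_def algebra_simps)
  then show "(2 * g - 1 - 3 * \<delta>) * r / 2 \<le> I"
    using ax(1) ay(1) eUV(2) upper unfolding I by simp
qed

text \<open>
  To first order, \<open>1 - 2 g\<close> is \<open>\<surd>3 c\<close> and \<open>1 - 4 g\<^sup>2\<close> is \<open>2 \<surd>3 c\<close>, and \<open>3.4642\<close> is just above \<open>2 \<surd>3\<close>.
  In the second estimate the term \<open>c\<^sup>2\<close> coming from \<open>2 u\<close> is compensated by \<open>-u\<^sup>2\<close>.
\<close>

lemma cos_pi_third_plus_bounds:
  assumes c: "0 < c" "c < (0.02::real)"
  defines "g \<equiv> cos (pi / 3 + c)"
  shows "0 < g" "1 - 2 * g \<le> 3.4642 * c" "1 - 4 * g\<^sup>2 \<le> 3.4642 * c"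
proof -
  define u where "u = 1.7321 * c + c\<^sup>2 / 2"
  have c2: "c\<^sup>2 \<le> 0.02 * c" using c by (simp add: power2_eq_square mult_right_mono)
  have "cos c = 1 - 2 * (sin (c / 2))\<^sup>2" using cos_double_sin[of "c / 2"] by simp
  moreover have "(sin (c / 2))\<^sup>2 \<le> (c / 2)\<^sup>2"
    using abs_sin_x_le_abs_x[of "c / 2"] unfolding abs_le_square_iff .
  ultimately have cos: "1 - c\<^sup>2 / 2 \<le> cos c" by (simp add: power2_eq_square)
  have "sqrt 3 \<le> 1.7321" by (rule real_le_lsqrt) (auto simp: power2_eq_square)
  then have "sqrt 3 * sin c \<le> 1.7321 * c"
    using sin_x_le_x[of c] sin_gt_zero[of c] c pi_gt3 by (intro mult_mono) auto
  moreover have "2 * g = cos c - sqrt 3 * sin c"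
    unfolding g_def cos_add cos_60 sin_60 by (simp add: field_simps)
  ultimately have g: "1 - u \<le> 2 * g" using cos by (simp add: u_def)
  have "c \<le> u" unfolding u_def using c by (intro add_increasing2) auto
  moreover have "u \<le> 1 / 2" "u \<le> 1.7421 * c" using c c2 by (simp_all add: u_def)
  ultimately have u: "c \<le> u" "u \<le> 1 / 2" "u \<le> 1.7421 * c" by simp_all
  show "0 < g" using g u by simp
  show "1 - 2 * g \<le> 3.4642 * c" using g u c by simp
  have "(1 - u)\<^sup>2 \<le> (2 * g)\<^sup>2" using g u by (intro power_mono) auto
  then have "1 - 4 * g\<^sup>2 \<le> 2 * u - u\<^sup>2" by (simp add: power2_eq_square algebra_simps)
  moreover have "c\<^sup>2 \<le> u\<^sup>2" using c u by (intro power_mono) auto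
  ultimately show "1 - 4 * g\<^sup>2 \<le> 3.4642 * c" by (simp add: u_def)
qed

section \<open>The bound on the cardinality\<close>

text \<open>
  Geometry and rank argument combined. The factor \<open>K\<close> is the loss in the passage to the nearly
  equilateral subsets. The choice \<open>\<delta> = c / 1000\<close> keeps all error terms within the gap between
  \<open>3.4642 c\<close> and \<open>3.48 c\<close>.
\<close>

lemma card_angles_below_le:
  assumes c: "0 < c" "c < (0.02::real)" and x: "0 < x" "x < (1::real)"
  shows "\<exists>K>0. \<forall>d k A. angles_below (pi / 3 + c) d A \<longrightarrow> finite A \<longrightarrow>
           ((3.48 * c)\<^sup>2 / x) ^ k * (1 / (1 - x)) ^ d \<le> 1 / 2 \<longrightarrow>
           real (card A) \<le> real K * (2 * ((1 / x) ^ k * (1 / (1 - x)) ^ d) + 1)"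
proof -
  define g where "g = cos (pi / 3 + c)"
  have g: "0 < g" "1 - 2 * g \<le> 3.4642 * c" "1 - 4 * g\<^sup>2 \<le> 3.4642 * c"
    unfolding g_def using cos_pi_third_plus_bounds[OF c] by auto
  have g1: "g \<le> 1" by (simp add: g_def)
  define \<delta> where "\<delta> = c / 1000"
  have \<delta>: "0 < \<delta>" using c by (simp add: \<delta>_def)
  define m where "m = nat \<lceil>1 / \<delta>\<rceil> + 1"
  have m: "m > 0" "1 / \<delta> \<le> real m" unfolding m_def by linarith+
  obtain K where K: "K > 0" and K_prop: "\<And>(D :: (nat \<Rightarrow> real) \<Rightarrow> (nat \<Rightarrow> real) \<Rightarrow> real) A T.
      (\<forall>x y. D x y = D y x) \<Longrightarrow> narrow_angles g D A \<Longrightarrow> finite A \<Longrightarrow> T > 0 \<Longrightarrow> card A \<ge> K * T \<Longrightarrow>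
      (\<exists>P S r. P \<subseteq> A \<and> S \<subseteq> A \<and> P \<inter> S = {} \<and> card P \<ge> m \<and> card S \<ge> T \<and> r > 0 \<and>
              (\<forall>p\<in>P. \<forall>q\<in>P \<union> S. p \<noteq> q \<longrightarrow> (D p q)\<^sup>2 \<in> {r..(1 + \<delta>) * r}))"
    using nearly_equilateral_subsets[OF g(1) g1 \<delta> m(1), where 'a = "nat \<Rightarrow> real"] by metis
  show ?thesis
  proof (intro exI[of _ K] conjI allI impI K)
    fix d k A
    assume A: "angles_below (pi / 3 + c) d A" "finite A"
      and k: "((3.48 * c)\<^sup>2 / x) ^ k * (1 / (1 - x)) ^ d \<le> 1 / 2"
    define B where "B = 2 * ((1 / x) ^ k * (1 / (1 - x)) ^ d)"
    define T where "T = nat \<lfloor>B\<rfloor> + 1"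
    have "B \<ge> 0" using x by (simp add: B_def)
    then have T: "T > 0" "B < real T" "real T \<le> B + 1" unfolding T_def by linarith+
    have nar: "narrow_angles g (eucl_dist d) A"
      unfolding g_def using A c pi_gt3 by (intro angles_below_narrow) auto
    show "real (card A) \<le> real K * (2 * ((1 / x) ^ k * (1 / (1 - x)) ^ d) + 1)"
    proof (rule ccontr)
      assume "\<not> ?thesis"
      then have "real K * (B + 1) < real (card A)" by (simp add: B_def)
      moreover have "real (K * T) \<le> real K * (B + 1)" using T K by (simp add: mult_left_mono)
      ultimately have "K * T \<le> card A" by linarith
      then obtain P S r where PS: "P \<subseteq> A" "S \<subseteq> A" "P \<inter> S = {}" "card P \<ge> m" "card S \<ge> T" and r: "r > 0"
        and near: "\<forall>p\<in>P. \<forall>q\<in>P \<union> S. p \<noteq> q \<longrightarrow> (eucl_dist d p q)\<^sup>2 \<in> {r..(1 + \<delta>) * r}"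
        using K_prop[OF _ nar A(2) T(1)] eucl_dist_commute by metis
      have fin: "finite P" "finite S" using finite_subset[OF PS(1) A(2)] finite_subset[OF PS(2) A(2)] by auto
      have nar': "narrow_angles g (eucl_dist d) (P \<union> S)"
        using nar PS unfolding narrow_angles_def by blast
      have cP: "1 / \<delta> \<le> real (card P)" using m PS(4) by linarith
      define I where "I x y = (\<Sum>i<d. (x i - centroid P i) * (y i - centroid P i))" for x y
      note bounds = centred_inner_bounds[OF g(1) g1 \<delta> r nar' PS(3) fin(1) cP near, folded I_def]
      define h where "h = (1 - \<delta>) * r / 2"
      have h: "h > 0" using r c by (simp add: h_def \<delta>_def)
      have diag: "h \<le> I u u" if "u \<in> S" for u
        using bounds(1)[OF that that] by (simp add: h_def)
      have off: "\<bar>I u v\<bar> \<le> 3.48 * c * h" if "u \<in> S" "v \<in> S" "u \<noteq> v" for u v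
      proof -
        have "0 \<le> c * (0.0128 - 0.00348 * c)" using c by (intro mult_nonneg_nonneg) auto
        also have "\<dots> = 3.48 * c * (1 - \<delta>) - (3.4642 * c + 3 * \<delta>)"
          by (simp add: \<delta>_def algebra_simps)
        finally have le: "3.4642 * c + 3 * \<delta> \<le> 3.48 * c * (1 - \<delta>)"
          by (simp only: diff_ge_0_iff_ge)
        define E where "E = 3.48 * c * (1 - \<delta>) * r"
        have "(1 - 4 * g\<^sup>2 + 3 * \<delta>) * r \<le> E"
          unfolding E_def using g le r by (intro mult_right_mono) auto
        moreover have "- E \<le> (2 * g - 1 - 3 * \<delta>) * r"
        proof -
          have "(1 - 2 * g + 3 * \<delta>) * r \<le> E"
            unfolding E_def using g le r by (intro mult_right_mono) auto
          moreover have "(2 * g - 1 - 3 * \<delta>) * r = - ((1 - 2 * g + 3 * \<delta>) * r)"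
            by (simp add: algebra_simps)
          ultimately show ?thesis by simp
        qed
        ultimately have "\<bar>I u v\<bar> \<le> E / 2"
          using bounds(2)[OF that] bounds(3)[OF that] unfolding abs_le_iff by simp
        also have "E / 2 = 3.48 * c * h" by (simp add: h_def E_def)
        finally show ?thesis .
      qed
      define w where "w u i = (u i - centroid P i) / sqrt (I u u)" for u i
      have w: "(\<Sum>i<d. w u i * w v i) = I u v / (sqrt (I u u) * sqrt (I v v))" for u v
        by (simp add: w_def I_def flip: sum_divide_distrib)
      have "real (card S) \<le> B"
        unfolding B_def
      proof (rule card_nearly_orthogonal_le[OF fin(2) x _ _ _ k, where w = w])
        show "0 \<le> 3.48 * c" using c by simp
        show "(\<Sum>i<d. w u i * w u i) = 1" if "u \<in> S" for u
          using diag[OF that] h unfolding w by simp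
        show "\<bar>\<Sum>i<d. w u i * w v i\<bar> \<le> 3.48 * c" if "u \<in> S" "v \<in> S" "u \<noteq> v" for u v
        proof -
          have pos: "I u u > 0" "I v v > 0" using diag that h by (meson less_le_trans)+
          have "sqrt h * sqrt h \<le> sqrt (I u u) * sqrt (I v v)"
            using diag[OF that(1)] diag[OF that(2)] h pos by (intro mult_mono) auto
          then have hle: "h \<le> sqrt (I u u) * sqrt (I v v)" using h by simp
          have "\<bar>I u v\<bar> \<le> 3.48 * c * h" by (rule off[OF that])
          also have "\<dots> \<le> 3.48 * c * (sqrt (I u u) * sqrt (I v v))"
            using c hle by (intro mult_left_mono) auto
          finally show ?thesis
            using pos unfolding w abs_divide by (simp add: divide_le_eq abs_mult)
        qed
      qed
      then show False using T PS(5) by linarith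
    qed
  qed
qed

section \<open>Exponential rates\<close>

lemma exp_one_bounds: "2.717 \<le> exp (1::real)" "exp (1::real) \<le> 2.72"
proof -
  have "\<bar>exp 1 - 5837465777 / 2147483648\<bar> \<le> (inverse (2 ^ 32)::real)" by (rule e_approx_32)
  then have "exp 1 - 5837465777 / 2147483648 \<le> (inverse (2 ^ 32)::real)"
    "5837465777 / 2147483648 - exp 1 \<le> (inverse (2 ^ 32)::real)"
    unfolding abs_le_iff by simp_all
  then show "2.717 \<le> exp (1::real)" "exp (1::real) \<le> 2.72" by simp_all
qed

text \<open>
  Since \<open>1 / (1 - x) = 1 + \<kappa> \<le> exp \<kappa>\<close>, it suffices that \<open>(3.48 c)\<^sup>2 / x < 1 / e\<close>. This means
  \<open>3.48\<^sup>2 e < 33\<close>, where the left side is about \<open>32.92\<close>; hence the choice \<open>x = 33 c\<^sup>2\<close>.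
\<close>

lemma decay_rate:
  assumes c: "0 < c" "c < (0.02::real)"
  defines "x \<equiv> 33 * c\<^sup>2"
  defines "\<kappa> \<equiv> x / (1 - x)"
  shows "((3.48 * c)\<^sup>2 / x) powr \<kappa> * (1 / (1 - x)) < 1"
proof -
  have "c\<^sup>2 < 0.02\<^sup>2" using c by (intro power_strict_mono) auto
  then have x: "0 < x" "x < 0.0132" using c by (simp_all add: x_def power2_eq_square)
  then have \<kappa>: "\<kappa> > 0" by (simp add: \<kappa>_def)
  have "1 / (1 - x) = 1 + \<kappa>" using x by (simp add: \<kappa>_def field_simps)
  also have "\<dots> \<le> exp \<kappa>" by (rule exp_ge_add_one_self)
  finally have 1: "1 / (1 - x) \<le> exp \<kappa>" .
  have "(3.48 * c)\<^sup>2 / x < exp (- 1)"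
    using exp_one_bounds(2) c by (simp add: x_def exp_minus power_mult_distrib field_simps)
  then have "((3.48 * c)\<^sup>2 / x) powr \<kappa> < exp (- 1) powr \<kappa>"
    using \<kappa> x by (intro powr_less_mono2) auto
  also have "\<dots> = exp (- \<kappa>)" by (simp add: powr_def)
  finally have "((3.48 * c)\<^sup>2 / x) powr \<kappa> * (1 / (1 - x)) < exp (- \<kappa>) * exp \<kappa>"
    using 1 x by (intro mult_less_le_imp_less) auto
  then show ?thesis by (simp flip: exp_add)
qed

text \<open>
  The left side is at most \<open>exp (\<kappa> (ln (1/x) + 1))\<close>. The logarithm is estimated by
  \<open>ln (0.02 / c) \<le> 0.02 / c - 1\<close>, which is sharp at \<open>c = 0.02\<close>, where the inequality is tightest: there the exponent is about \<open>0.0713\<close> and the logarithm of the right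
  side about \<open>0.0723\<close>.
\<close>

lemma growth_rate:
  assumes c: "0 < c" "c < (0.02::real)"
  defines "x \<equiv> 33 * c\<^sup>2"
  defines "\<kappa> \<equiv> x / (1 - x)"
  shows "(1 / x) powr \<kappa> * (1 / (1 - x)) < 1 + 3.75 * c"
proof -
  have "c\<^sup>2 < 0.02\<^sup>2" using c by (intro power_strict_mono) auto
  then have x: "0 < x" "x < 0.0132" using c by (simp_all add: x_def power2_eq_square)
  then have \<kappa>: "\<kappa> > 0" by (simp add: \<kappa>_def)
  have "1 / (1 - x) = 1 + \<kappa>" using x by (simp add: \<kappa>_def field_simps)
  also have "\<dots> \<le> exp \<kappa>" by (rule exp_ge_add_one_self)
  finally have 1: "1 / (1 - x) \<le> exp \<kappa>" .
  have "ln (1 / x) \<le> 7 / 3 + 0.04 / c"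
  proof -
    \<comment> \<open>\<open>2500 / 33\<close> is the value of \<open>1 / x\<close> at \<open>c = 0.02\<close>.\<close>
    have "(2500 / 33 :: real) ^ 3 \<le> 2.717 ^ 13" by (simp add: field_simps)
    also have "\<dots> \<le> exp 1 ^ 13" using exp_one_bounds by (intro power_mono) auto
    also have "\<dots> = exp (13 / 3) ^ 3" by (simp flip: exp_of_nat_mult)
    finally have "2500 / 33 \<le> exp (13 / 3 :: real)" by (rule power_le_imp_le_base[of _ 2, simplified]) auto
    then have "ln (2500 / 33) \<le> ln (exp (13 / 3 :: real))" by (subst ln_le_cancel_iff) auto
    then have a: "ln (2500 / 33 :: real) \<le> 13 / 3" by simp
    have b: "ln (0.02 / c) \<le> 0.02 / c - 1" using c by (intro ln_le_minus_one) auto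
    have "1 / x = 2500 / 33 * (0.02 / c)\<^sup>2" by (simp add: x_def power2_eq_square)
    then have "ln (1 / x) = ln (2500 / 33 * (0.02 / c)\<^sup>2)" by (simp only:)
    also have "\<dots> = ln (2500 / 33) + ln ((0.02 / c)\<^sup>2)"
      by (rule ln_mult_pos) (use c in auto)
    also have "ln ((0.02 / c)\<^sup>2) = 2 * ln (0.02 / c)"
      by (subst ln_realpow) (use c in auto)
    finally show ?thesis using a b by simp
  qed
  then have "\<kappa> * (ln (1 / x) + 1) \<le> \<kappa> * (10 / 3 + 0.04 / c)"
    using \<kappa> by (intro mult_left_mono) auto
  also have "\<dots> \<le> (x / 0.9868) * (10 / 3 + 0.04 / c)"
    using x c unfolding \<kappa>_def by (intro mult_right_mono divide_left_mono) auto
  also have "\<dots> = (33 / 0.9868) * c * (10 / 3 * c + 0.04)"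
    using c by (simp add: x_def power2_eq_square field_simps)
  also have "\<dots> \<le> (33 / 0.9868) * c * (10 / 3 * 0.02 + 0.04)"
    using c by (intro mult_left_mono) auto
  also have "\<dots> \<le> 4 * (0.892 * c)" using c by simp
  finally have e: "\<kappa> * (ln (1 / x) + 1) \<le> 4 * (0.892 * c)" .
  \<comment> \<open>The exponent is at most \<open>4 t\<close>, and \<open>exp (- t) \<ge> 1 - t\<close>. Taking the fourth power makes this
    elementary bound for the exponential sharp enough.\<close>
  define t where "t = 0.892 * c"
  have t: "0 < t" "t < 0.02" using c by (simp_all add: t_def)
  have "1 < (1 + 3.75 * c) * (1 - t) ^ 4"
  proof -
    have "t\<^sup>2 * (0.02 * 4) \<ge> t\<^sup>2 * (t * 4)" using t by (intro mult_left_mono) auto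
    then have "1 - 4 * t + 5.92 * t\<^sup>2 \<le> 1 - 4 * t + 6 * t\<^sup>2 - 4 * t ^ 3"
      by (simp add: power2_eq_square power3_eq_cube)
    also have "\<dots> \<le> 1 - 4 * t + 6 * t\<^sup>2 - 4 * t ^ 3 + t ^ 4" by simp
    also have "\<dots> = (1 - t) ^ 4"
      by (simp add: power2_eq_square power3_eq_cube power4_eq_xxxx algebra_simps)
    finally have "(1 + 3.75 * c) * (1 - 4 * t + 5.92 * t\<^sup>2) \<le> (1 + 3.75 * c) * (1 - t) ^ 4"
      using c by (intro mult_left_mono) auto
    moreover have "1 < (1 + 3.75 * c) * (1 - 4 * t + 5.92 * t\<^sup>2)"
    proof -
      have "0 < c * (0.182 - 8.66966912 * c) + 17.6637408 * c ^ 3"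
        using c by (intro add_pos_pos mult_pos_pos) auto
      also have "\<dots> = (1 + 3.75 * c) * (1 - 4 * t + 5.92 * t\<^sup>2) - 1"
        by (simp add: t_def power2_eq_square power3_eq_cube field_simps)
      finally show ?thesis by (simp only: diff_gt_0_iff_gt)
    qed
    ultimately show ?thesis by linarith
  qed
  also have "\<dots> \<le> (1 + 3.75 * c) * exp (- t) ^ 4"
    using c t exp_ge_add_one_self[of "- t"] by (intro mult_left_mono power_mono) auto
  also have "exp (- t) ^ 4 = exp (- (4 * t))" by (simp flip: exp_of_nat_mult)
  finally have "exp (4 * t) < 1 + 3.75 * c"
    by (simp add: exp_minus field_simps)
  have "(1 / x) powr \<kappa> * (1 / (1 - x)) \<le> (1 / x) powr \<kappa> * exp \<kappa>"
    using 1 by (intro mult_left_mono) auto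
  also have "\<dots> = exp (\<kappa> * (ln (1 / x) + 1))"
    using x by (simp add: powr_def algebra_simps flip: exp_add)
  also have "\<dots> \<le> exp (4 * t)" using e by (simp add: t_def)
  also have "\<dots> < 1 + 3.75 * c" by fact
  finally show ?thesis .
qed

section \<open>The asymptotic bound\<close>

theorem theorem1p2:
  fixes c :: real
  assumes "0 < c" and "c < 0.02"
  shows "\<forall>\<^sub>F d in sequentially.
           ereal_of_enat (max_card_angles (pi / 3 + c) d) < ereal ((1 + 3.75 * c) ^ d)"
proof -
  define x where "x = 33 * c\<^sup>2"
  define \<kappa> where "\<kappa> = x / (1 - x)"
  define a where "a = (3.48 * c)\<^sup>2 / x"
  define q where "q = a powr \<kappa> * (1 / (1 - x))"
  define b where "b = (1 / x) powr \<kappa> * (1 / (1 - x))"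
  define Q where "Q = 1 + 3.75 * c"
  have "c\<^sup>2 < 0.02\<^sup>2" using assms by (intro power_strict_mono) auto
  then have x: "0 < x" "x < 1" using assms by (simp_all add: x_def power2_eq_square)
  then have \<kappa>: "\<kappa> > 0" by (simp add: \<kappa>_def)
  have a: "0 < a" "a \<le> 1" using assms by (simp_all add: a_def x_def power_mult_distrib field_simps)
  have q: "0 < q" "q < 1"
    using decay_rate[OF assms] a x by (simp_all add: q_def a_def x_def \<kappa>_def)
  have "1 \<le> (1 / x) powr \<kappa>" using x \<kappa> by (intro ge_one_powr_ge_zero) auto
  then have "1 * 1 \<le> b" unfolding b_def using x by (intro mult_mono) auto
  then have b: "1 \<le> b" "b < Q"
    using growth_rate[OF assms] by (simp_all add: b_def Q_def x_def \<kappa>_def)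
  obtain K :: nat where K: "K > 0" and bound: "\<And>d k A. angles_below (pi / 3 + c) d A \<Longrightarrow> finite A \<Longrightarrow>
      a ^ k * (1 / (1 - x)) ^ d \<le> 1 / 2 \<Longrightarrow>
      real (card A) \<le> real K * (2 * ((1 / x) ^ k * (1 / (1 - x)) ^ d) + 1)"
    using card_angles_below_le[OF assms x] unfolding a_def by metis
  define C where "C = real K * (2 / x + 1)"
  have C: "C > 0" using K x by (simp add: C_def add_pos_pos)
  have card: "real (card A) \<le> C * b ^ d"
    if A: "angles_below (pi / 3 + c) d A" "finite A" and d: "q ^ d \<le> 1 / 2" for d A
  proof -
    \<comment> \<open>Rounding \<open>\<kappa> d\<close> up helps in the decaying factor and costs a factor \<open>1 / x\<close> in the growing one.\<close>
    define k where "k = nat \<lceil>\<kappa> * real d\<rceil>"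
    have k: "\<kappa> * d \<le> k" "k \<le> \<kappa> * d + 1"
      using \<kappa> by (auto simp: k_def)
    have "a ^ k = a powr k" using a by (simp add: powr_realpow)
    also have "\<dots> \<le> a powr (\<kappa> * d)" using a k by (intro powr_mono') auto
    also have "\<dots> = (a powr \<kappa>) ^ d" using a by (simp add: powr_powr powr_power mult.commute)
    finally have "a ^ k * (1 / (1 - x)) ^ d \<le> (a powr \<kappa>) ^ d * (1 / (1 - x)) ^ d"
      using x by (intro mult_right_mono) auto
    also have "\<dots> = q ^ d" by (simp only: q_def power_mult_distrib)
    finally have "real (card A) \<le> real K * (2 * ((1 / x) ^ k * (1 / (1 - x)) ^ d) + 1)"
      using bound[OF A] d by simp
    moreover have "(1 / x) ^ k * (1 / (1 - x)) ^ d \<le> b ^ d / x"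
    proof -
      have "(1 / x) ^ k = (1 / x) powr k" using x by (simp add: powr_realpow)
      also have "\<dots> \<le> (1 / x) powr (\<kappa> * d + 1)" using x k by (intro powr_mono) auto
      also have "\<dots> = ((1 / x) powr \<kappa>) ^ d * (1 / x)"
        using x unfolding powr_add by (simp add: powr_powr powr_power mult.commute)
      finally have "(1 / x) ^ k * (1 / (1 - x)) ^ d \<le> ((1 / x) powr \<kappa>) ^ d * (1 / x) * (1 / (1 - x)) ^ d"
        using x by (intro mult_right_mono) auto
      also have "\<dots> = b ^ d / x" unfolding b_def power_mult_distrib by simp
      finally show ?thesis .
    qed
    moreover have "1 \<le> b ^ d" using b by simp
    ultimately have "real (card A) \<le> real K * (2 * (b ^ d / x) + b ^ d)"
      using K by (smt (verit) mult_left_mono of_nat_0_le_iff)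
    then show ?thesis by (simp add: C_def algebra_simps)
  qed
  have "(\<lambda>d. q ^ d) \<longlonglongrightarrow> 0" using q by (intro LIMSEQ_realpow_zero) auto
  then have ev1: "\<forall>\<^sub>F d in sequentially. q ^ d < 1 / 2" by (rule order_tendstoD) simp
  have "(\<lambda>d. (b / Q) ^ d) \<longlonglongrightarrow> 0" using b by (intro LIMSEQ_realpow_zero) auto
  then have ev2: "\<forall>\<^sub>F d in sequentially. (b / Q) ^ d < 1 / C"
    by (rule order_tendstoD) (use C in simp)
  from ev1 ev2 show ?thesis
  proof eventually_elim
    case (elim d)
    \<comment> \<open>An infinite set contains finite subsets of every cardinality, so the bound \<open>n\<close> for
      finite sets also rules out infinite ones.\<close>
    define n where "n = nat \<lfloor>C * b ^ d\<rfloor>"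
    have "C * b ^ d \<ge> 0" using C b by simp
    then have n: "real n \<le> C * b ^ d" "C * b ^ d < real n + 1" unfolding n_def by linarith+
    have fin_card: "card A \<le> n" if "angles_below (pi / 3 + c) d A" "finite A" for A
      using card[OF that] elim(1) n by simp
    have "(if finite A then enat (card A) else \<infinity>) \<le> enat n" if A: "angles_below (pi / 3 + c) d A" for A
    proof (cases "finite A")
      case True
      then show ?thesis using fin_card A by simp
    next
      case False
      then obtain A' where A': "A' \<subseteq> A" "finite A'" "card A' = Suc n"
        using infinite_arbitrarily_large by blast
      then have "angles_below (pi / 3 + c) d A'"
        using A angles_below_subset by blast
      then show ?thesis using fin_card[of A'] A' by simp
    qed
    then have "max_card_angles (pi / 3 + c) d \<le> enat n"
      unfolding max_card_angles_def by (intro SUP_least) auto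
    then have "ereal_of_enat (max_card_angles (pi / 3 + c) d) \<le> ereal (real n)"
      using ereal_of_enat_le_iff[of _ "enat n"] by simp
    also have "ereal (real n) < ereal ((1 + 3.75 * c) ^ d)"
    proof -
      have "C * b ^ d < Q ^ d" using elim(2) C b by (simp add: power_divide field_simps)
      then show ?thesis using n(1) by (simp add: Q_def)
    qed
    finally show ?case .
  qed
qed

end
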